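(* Fix an index $p$, $1<p<\infty$, and suppose $\phi$ is a non-trivial weight on $\mathbb R_+=(0,\infty)$. Take $\rho=\rho_{p,\phi}$ on $\mathfrak M_+(\mathbb R_+)$. Then, for $t\in\mathbb R_+$, $$h_\rho(t)\approx M_\rho(t)\approx\sup_{s\in\mathbb R_+}\left[\frac{\int_0^{st}\phi(y)\,dy+s^pt^p\int_{st}^\infty\phi(y)y^{-p}\,dy}{\int_0^s\phi(y)\,dy+s^p\int_s^\infty\phi(y)y^{-p}\,dy}\right]^{1/p},$$ with equivalence constants independent of $t$, and $$i_\rho=\underline i_\rho,\qquad I_\rho=\underline I_\rho .$$
   Context: $\mathfrak M_+(\mathbb R_+)$ is the set of nonnegative Lebesgue measurable functions on $\mathbb R_+=(0,\infty)$. For such $f$, $f^*(t):=\inf\{\lambda>0:|\{x\in\mathbb R_+:f(x)>\lambda\}|\le t\}$ is the decreasing rearrangement and $f^{**}(t):=t^{-1}\int_0^tf^*(s)\,ds$. A weight on $\mathbb R_+$ is a positive locally integrable function, integrable on $(0,t)$ for every finite $t$. The norm is $\rho_{p,\phi}(f):=\left[\int_0^\infty f^{**}(t)^p\phi(t)\,dt\right]^{1/p}$. The weight $\phi$ is non-trivial if $\int_1^\infty\phi(t)t^{-p}\,dt<\infty$ and $\int_0^c\phi(t)t^{-p}\,dt=\infty$ for all $c\in(0,\infty)$. The dilation operator is $(E_sf)(t):=f(st)$. The function $h_\rho(t)$ is the operator norm of $E_{1/t}$ on the space $L_\rho(\mathbb R_+)=\{f:\rho(|f|)<\infty\}$, i.e.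 $h_\rho(t)=\sup\{\rho(E_{1/t}f)/\rho(f):0\ne f\in\mathfrak M_+(\mathbb R_+),\ \rho(f)<\infty\}$. The function $M_\rho$ is $M_\rho(t):=\sup_{0<a<\infty}\rho(\chi_{(0,at)})/\rho(\chi_{(0,a)})$. The lower and upper Boyd indices are $i_\rho:=\sup_{0<t<1}\frac{\log h_\rho(t)}{\log t}$ and $I_\rho:=\inf_{1<t<\infty}\frac{\log h_\rho(t)}{\log t}$; the fundamental indices are $\underline i_\rho:=\sup_{0<s<1}\frac{\log M_\rho(s)}{\log s}$ and $\underline I_\rho:=\inf_{1<s<\infty}\frac{\log M_\rho(s)}{\log s}$. *)

theory Defs
  imports "HOL-Analysis.Analysis"
begin

text \<open>Functions on \<open>\<real>\<^sub>+ = (0,\<infinity>)\<close> are rendered as functions on the type of reals; every notion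
  below only looks at their values on \<open>{0<..}\<close>.  All norms, suprema and integrals are taken
  in \<open>[0,\<infinity>]\<close>, so that no convergence assumption is hidden in a totalised operation.\<close>

definition epowr :: "ennreal \<Rightarrow> real \<Rightarrow> ennreal" where  \<comment> \<open>only meant for exponents \<open>r > 0\<close>\<close>
  "epowr x r = (if x = top then top else ennreal (enn2real x powr r))"

definition elog :: "ennreal \<Rightarrow> ereal" where
  "elog x = (if x = 0 then - \<infinity> else if x = top then \<infinity> else ereal (ln (enn2real x)))"

definition M_plus :: "(real \<Rightarrow> ennreal) set" where
  "M_plus = borel_measurable (lebesgue_on {0<..})"

definition rearr :: "(real \<Rightarrow> ennreal) \<Rightarrow> real \<Rightarrow> ennreal" where
  "rearr f t = Inf {l. 0 < l \<and> emeasure lebesgue {x \<in> {0<..}. f x > l} \<le> ennreal t}"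

definition max_rearr :: "(real \<Rightarrow> ennreal) \<Rightarrow> real \<Rightarrow> ennreal" where
  "max_rearr f t = (\<integral>\<^sup>+s\<in>{0<..<t}. rearr f s \<partial>lebesgue) / ennreal t"

text \<open>Integrability on all \<open>(0,t)\<close> subsumes both measurability and local integrability
  on \<open>(0,\<infinity>)\<close>.\<close>

definition weight :: "(real \<Rightarrow> real) \<Rightarrow> bool" where
  "weight \<phi> \<longleftrightarrow> (\<forall>x>0. \<phi> x > 0) \<and> (\<forall>t>0. set_integrable lebesgue {0<..<t} \<phi>)"

definition nontrivial_weight :: "real \<Rightarrow> (real \<Rightarrow> real) \<Rightarrow> bool" where
  "nontrivial_weight p \<phi> \<longleftrightarrow> weight \<phi> \<and>
     (\<integral>\<^sup>+t\<in>{1<..}. ennreal (\<phi> t * t powr (- p)) \<partial>lebesgue) < top \<and>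
     (\<forall>c>0. (\<integral>\<^sup>+t\<in>{0<..<c}. ennreal (\<phi> t * t powr (- p)) \<partial>lebesgue) = top)"

definition rho :: "real \<Rightarrow> (real \<Rightarrow> real) \<Rightarrow> (real \<Rightarrow> ennreal) \<Rightarrow> ennreal" where
  "rho p \<phi> f = epowr (\<integral>\<^sup>+t\<in>{0<..}. epowr (max_rearr f t) p * ennreal (\<phi> t) \<partial>lebesgue) (1 / p)"

definition dilation :: "real \<Rightarrow> (real \<Rightarrow> ennreal) \<Rightarrow> real \<Rightarrow> ennreal" where
  "dilation s f = (\<lambda>t. f (s * t))"

text \<open>As usual in function spaces, \<open>f \<noteq> 0\<close> means that \<open>f\<close> is not almost everywhere zero.\<close>

definition dilation_norm :: "((real \<Rightarrow> ennreal) \<Rightarrow> ennreal) \<Rightarrow> real \<Rightarrow> ennreal" where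
  "dilation_norm \<rho> t = Sup {\<rho> (dilation (1 / t) f) / \<rho> f | f.
     f \<in> M_plus \<and> \<not> (AE x in lebesgue_on {0<..}. f x = 0) \<and> \<rho> f < top}"

definition M_fun :: "((real \<Rightarrow> ennreal) \<Rightarrow> ennreal) \<Rightarrow> real \<Rightarrow> ennreal" where
  "M_fun \<rho> t = (SUP a\<in>{0<..}. \<rho> (indicator {0<..<a * t}) / \<rho> (indicator {0<..<a}))"

definition lower_Boyd :: "((real \<Rightarrow> ennreal) \<Rightarrow> ennreal) \<Rightarrow> ereal" where
  "lower_Boyd \<rho> = (SUP t\<in>{0<..<1}. elog (dilation_norm \<rho> t) / ereal (ln t))"

definition upper_Boyd :: "((real \<Rightarrow> ennreal) \<Rightarrow> ennreal) \<Rightarrow> ereal" where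
  "upper_Boyd \<rho> = (INF t\<in>{1<..}. elog (dilation_norm \<rho> t) / ereal (ln t))"

definition lower_fundamental :: "((real \<Rightarrow> ennreal) \<Rightarrow> ennreal) \<Rightarrow> ereal" where
  "lower_fundamental \<rho> = (SUP s\<in>{0<..<1}. elog (M_fun \<rho> s) / ereal (ln s))"

definition upper_fundamental :: "((real \<Rightarrow> ennreal) \<Rightarrow> ennreal) \<Rightarrow> ereal" where
  "upper_fundamental \<rho> = (INF s\<in>{1<..}. elog (M_fun \<rho> s) / ereal (ln s))"

definition equivalent_on_pos :: "(real \<Rightarrow> ennreal) \<Rightarrow> (real \<Rightarrow> ennreal) \<Rightarrow> bool" where
  "equivalent_on_pos F G \<longleftrightarrow>
     (\<exists>c C :: real. 0 < c \<and> 0 < C \<and>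
        (\<forall>t>0. ennreal c * G t \<le> F t \<and> F t \<le> ennreal C * G t))"

end

theory Submission
  imports Defs
begin

text \<open>Put \<open>D(a) = \<integral> min(1, a/x)^p \<phi>(x) dx\<close>, the \<open>p\<close>-th power of the norm of the characteristic function
  of \<open>(0,a)\<close>.  Let \<open>u\<close> be the rearrangement of \<open>f\<close> and \<open>g\<close> its primitive.  Integrating
  \<open>(g^p)' = p g^(p-1) u\<close> gives \<open>f**(x)^p = x^(-p) \<integral> p s^(p-1) m(s) ds\<close> over \<open>(0,x)\<close>, where
  \<open>m(s) = u(s) (g(s)/s)^(p-1)\<close> is decreasing.  The superlevel sets of \<open>m\<close> are intervals \<open>(0,r)\<close>, so the
  layer cake formula turns \<open>f**(x)^p\<close> into a superposition of functions \<open>min(1, r/x)^p\<close>.  Integrated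
  against \<open>\<phi>\<close>, a bound \<open>D(at) \<le> C D(a)\<close> for all \<open>a\<close> thus passes to every \<open>f\<close> with the same constant.
  Hence \<open>h\<^sub>\<rho> = M\<^sub>\<rho>\<close> exactly, and the equality of indices needs no limiting argument.\<close>

subsection \<open>Powers in the extended half-line\<close>

lemma epowr_mono: "x \<le> y \<Longrightarrow> 0 < r \<Longrightarrow> epowr x r \<le> epowr y r"
  by (cases x; cases y)
    (auto simp: epowr_def top_unique intro!: ennreal_leI powr_mono2)

lemma epowr_ennreal: "0 \<le> x \<Longrightarrow> epowr (ennreal x) r = ennreal (x powr r)"
  by (simp add: epowr_def)

text \<open>The product of \<open>0\<close> and \<open>top\<close> is \<open>0\<close> on both
  sides, so the rule survives on all of [0,\<infinity>]. Once a factor \<open>top\<close> has been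
  split off, only finite pairs remain, where this is the rule for \<open>powr\<close>.\<close>

lemma epowr_mult:
  assumes "0 < r" shows "epowr (x * y) r = epowr x r * epowr y r"
proof -
  have top: "epowr (top * z) r = epowr top r * epowr z r" for z
    by (cases "z = 0") (auto simp: epowr_def ennreal_top_mult ennreal_eq_0_iff enn2real_eq_0_iff)
  show ?thesis
    using top[of x] top[of y]
    by (cases x; cases y) (auto simp: epowr_ennreal powr_mult mult.commute simp flip: ennreal_mult)
qed

lemma epowr_inverse:
  assumes "0 < r" shows "epowr (inverse x) r = inverse (epowr x r)"
proof (cases x)
  case (real a)
  with assms show ?thesis
    by (cases "a = 0") (auto simp: epowr_def inverse_ennreal inverse_powr)
qed (use assms in \<open>simp add: epowr_def\<close>)

lemma epowr_divide: "0 < r \<Longrightarrow> epowr (x / y) r = epowr x r / epowr y r"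
  by (simp add: divide_ennreal_def epowr_mult epowr_inverse)

lemma epowr_epowr_inverse:
  "0 < r \<Longrightarrow> epowr (epowr x r) (1 / r) = x"
  "0 < r \<Longrightarrow> epowr (epowr x (1 / r)) r = x"
  by (cases x; simp add: epowr_ennreal powr_powr epowr_def[of top])+

subsection \<open>Powers of primitives of decreasing functions\<close>

text \<open>Along a uniform partition of [a, b] into n pieces, each length is (b - a)/n and the
  increments of \<open>\<kappa>\<close> telescope. The total change of \<open>H\<close> is therefore
  at most c/n for every n.\<close>

lemma constant_if_increments_small:
  fixes H \<kappa> :: "real \<Rightarrow> real"
  assumes "a \<le> b"
    and incr: "\<And>x y. a \<le> x \<Longrightarrow> x \<le> y \<Longrightarrow> y \<le> b \<Longrightarrow> \<bar>H y - H x\<bar> \<le> (\<kappa> y - \<kappa> x) * (y - x)"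
  shows "H b = H a"
proof -
  define c where "c = (\<kappa> b - \<kappa> a) * (b - a)"
  have bound: "\<bar>H b - H a\<bar> \<le> c / real n" if "n > 0" for n
  proof -
    define X where "X i = a + (b - a) * (real i / real n)" for i
    have X0: "X 0 = a" and Xn: "X n = b"
      using that by (auto simp: X_def)
    have step: "X (Suc i) - X i = (b - a) / real n" for i
      using that by (simp add: X_def field_simps)
    have ge: "a \<le> X i" for i using assms(1) by (simp add: X_def)
    have mono: "X i \<le> X (Suc i)" for i
      using step[of i] assms(1) by (smt (verit) divide_nonneg_nonneg of_nat_0_le_iff)
    have le: "X (Suc i) \<le> b" if "i < n" for i
    proof -
      have "(b - a) * (real (Suc i) / real n) \<le> (b - a) * 1"
        using that assms(1) by (intro mult_left_mono) auto
      then show ?thesis unfolding X_def by simp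
    qed
    have "\<bar>H b - H a\<bar> = \<bar>\<Sum>i<n. H (X (Suc i)) - H (X i)\<bar>"
      by (simp add: sum_lessThan_telescope[of "\<lambda>i. H (X i)"] X0 Xn)
    also have "\<dots> \<le> (\<Sum>i<n. \<bar>H (X (Suc i)) - H (X i)\<bar>)"
      by (rule sum_abs)
    also have "\<dots> \<le> (\<Sum>i<n. (\<kappa> (X (Suc i)) - \<kappa> (X i)) * ((b - a) / real n))"
      using incr[OF ge mono le] by (intro sum_mono) (simp add: step)
    also have "\<dots> = c / real n"
      by (simp add: sum_lessThan_telescope[of "\<lambda>i. \<kappa> (X i)"] X0 Xn c_def flip: sum_distrib_right sum_divide_distrib)
    finally show ?thesis .
  qed
  have "\<bar>H b - H a\<bar> \<le> 0"
    using lim_const_over_n[of c] bound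
    by (intro LIMSEQ_le_const) (auto intro!: exI[of _ 1])
  then show ?thesis by simp
qed

text \<open>The mean value theorem, with a derivative that increases because p > 1.
  Differentiability is needed only inside the interval, so x = 0 is allowed.\<close>

lemma powr_diff_bounds:
  fixes x y p :: real
  assumes "1 < p" "0 \<le> x" "x \<le> y"
  shows "p * x powr (p - 1) * (y - x) \<le> y powr p - x powr p"
    and "y powr p - x powr p \<le> p * y powr (p - 1) * (y - x)"
proof -
  have "\<exists>z. x \<le> z \<and> z \<le> y \<and> y powr p - x powr p = p * z powr (p - 1) * (y - x)"
  proof (cases "x = y")
    case False
    then have "x < y" using assms by simp
    moreover have "continuous_on {x..y} (\<lambda>z. z powr p)"
      using assms by (intro continuous_on_powr' continuous_intros) auto
    moreover have "((\<lambda>z. z powr p) has_real_derivative p * z powr (p - 1)) (at z)" if "x < z" "z < y" for z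
      using that assms by (intro has_real_derivative_powr) auto
    ultimately obtain l z where "x < z" "z < y" "DERIV (\<lambda>z. z powr p) z :> l" "y powr p - x powr p = (y - x) * l"
      using MVT[of x y "\<lambda>z. z powr p"] by (force simp: real_differentiable_def)
    moreover from this have "l = p * z powr (p - 1)"
      using assms by (intro DERIV_unique[OF _ has_real_derivative_powr]) auto
    ultimately show ?thesis by (intro exI[of _ z]) (auto simp: algebra_simps)
  qed auto
  then obtain z where z: "x \<le> z" "z \<le> y" and eq: "y powr p - x powr p = p * z powr (p - 1) * (y - x)"
    by blast
  show "p * x powr (p - 1) * (y - x) \<le> y powr p - x powr p"
    unfolding eq using assms z by (intro mult_right_mono mult_left_mono powr_mono2) auto
  show "y powr p - x powr p \<le> p * y powr (p - 1) * (y - x)"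
    unfolding eq using assms z by (intro mult_right_mono mult_left_mono powr_mono2) auto
qed

text \<open>The increment is the integral over the half-open interval \<open>{x..<y}\<close>, which
  completes \<open>{0<..<x}\<close> to \<open>{0<..<y}\<close> exactly; it is compared with the
  integrals of the two constants. Finiteness of \<open>F y\<close> makes the subtraction of reals
  faithful.\<close>

lemma nn_integral_increment_bounds:
  fixes f :: "real \<Rightarrow> real"
  defines "F \<equiv> \<lambda>x. \<integral>\<^sup>+s\<in>{0<..<x}. ennreal (f s) \<partial>lborel"
  assumes [measurable]: "f \<in> borel_measurable borel"
    and xy: "0 < x" "x \<le> y" and fin: "F y < top"
    and bounds: "\<And>s. x \<le> s \<Longrightarrow> s < y \<Longrightarrow> c \<le> f s \<and> f s \<le> C" "0 \<le> c" "0 \<le> C"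
  shows "c * (y - x) \<le> enn2real (F y) - enn2real (F x)"
    and "enn2real (F y) - enn2real (F x) \<le> C * (y - x)"
proof -
  define R where "R = (\<integral>\<^sup>+s\<in>{x..<y}. ennreal (f s) \<partial>lborel)"
  have split: "F y = F x + R"
    unfolding F_def R_def using xy
    by (subst nn_integral_add[symmetric]) (auto intro!: nn_integral_cong split: split_indicator)
  have const: "(\<integral>\<^sup>+s\<in>{x..<y}. ennreal k \<partial>lborel) = ennreal (k * (y - x))" if "0 \<le> k" for k
    using xy that by (simp add: nn_integral_cmult_indicator ennreal_mult)
  have lower: "ennreal (c * (y - x)) \<le> R"
    unfolding R_def const[OF bounds(2), symmetric] using bounds(1)
    by (intro nn_integral_mono) (auto split: split_indicator intro!: ennreal_leI)
  have upper: "R \<le> ennreal (C * (y - x))"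
    unfolding R_def const[OF bounds(3), symmetric] using bounds(1)
    by (intro nn_integral_mono) (auto split: split_indicator intro!: ennreal_leI)
  have "F x < top" "R < top"
    using fin unfolding split by (auto simp: less_top)
  then have eq: "enn2real (F y) - enn2real (F x) = enn2real R"
    unfolding split by (subst enn2real_plus) (auto simp: less_top)
  show "c * (y - x) \<le> enn2real (F y) - enn2real (F x)"
    unfolding eq using lower \<open>R < top\<close> by (cases R) (auto simp: ennreal_le_iff)
  show "enn2real (F y) - enn2real (F x) \<le> C * (y - x)"
    unfolding eq using upper bounds(3) xy by (cases R) (auto simp: ennreal_le_iff top_unique)
qed

text \<open>Continuity from above for the measure with density \<open>f\<close>: the intervals (0,
  1/(n+1)) decrease to the empty set and have finite measure.\<close>

lemma nn_integral_initial_small: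
  fixes f :: "real \<Rightarrow> ennreal"
  assumes [measurable]: "f \<in> borel_measurable borel"
    and fin: "(\<integral>\<^sup>+s\<in>{0<..<1}. f s \<partial>lborel) < top" and "0 < e"
  shows "\<exists>x>0. (\<integral>\<^sup>+s\<in>{0<..<x}. f s \<partial>lborel) < e"
proof -
  define \<nu> where "\<nu> = density lborel f"
  define A where "A n = {0<..<1 / real (Suc n)}" for n
  have em: "emeasure \<nu> {0<..<x} = (\<integral>\<^sup>+s\<in>{0<..<x}. f s \<partial>lborel)" for x
    by (simp add: \<nu>_def emeasure_density)
  have "decseq A"
    unfolding A_def by (intro decseq_SucI) (force simp: frac_le intro: less_le_trans[OF _ divide_left_mono])
  moreover have "emeasure \<nu> (A n) \<noteq> \<infinity>" for n
  proof -
    have "1 / real (Suc n) \<le> 1" by simp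
    then have "A n \<subseteq> {0<..<1}"
      unfolding A_def
      by (intro greaterThanLessThan_subseteq_greaterThanLessThan[THEN iffD2]) simp
    then have "emeasure \<nu> (A n) \<le> emeasure \<nu> {0<..<1}"
      by (intro emeasure_mono) (auto simp: \<nu>_def)
    with fin show ?thesis by (auto simp: em top_unique less_top)
  qed
  moreover have "(\<Inter>n. A n) = {}"
  proof (intro equals0I)
    fix x assume x: "x \<in> (\<Inter>n. A n)"
    then have "0 < x" by (auto simp: A_def)
    then obtain n where "1 / real (Suc n) < x" using nat_approx_posE by blast
    moreover have "x \<in> A n" using x by blast
    ultimately show False by (simp add: A_def)
  qed
  moreover have "range A \<subseteq> sets \<nu>" by (auto simp: A_def \<nu>_def)
  ultimately have "(\<lambda>n. emeasure \<nu> (A n)) \<longlonglongrightarrow> 0"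
    using Lim_emeasure_decseq[of A \<nu>] by (metis emeasure_empty)
  then have "eventually (\<lambda>n. emeasure \<nu> (A n) < e) sequentially"
    using \<open>0 < e\<close> by (rule order_tendstoD)
  then obtain n where "emeasure \<nu> (A n) < e" by (auto simp: eventually_sequentially)
  then show ?thesis
    by (intro exI[of _ "1 / real (Suc n)"]) (simp add: A_def em)
qed

text \<open>The fundamental theorem of calculus for \<open>g powr p\<close>, where \<open>g\<close> is the primitive of \<open>u\<close>.  Since \<open>g\<close>
  fails to be differentiable at the possibly infinitely many jumps of \<open>u\<close>, the two sides are compared
  through increments: over \<open>[x, y]\<close> their difference is at most \<open>(\<kappa> y - \<kappa> x) * (y - x)\<close> for a
  monotone \<open>\<kappa>\<close>, and such errors vanish under refinement.\<close>

lemma powr_primitive_of_decreasing: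
  fixes u :: "real \<Rightarrow> real" and p :: real
  defines "G \<equiv> \<lambda>x. \<integral>\<^sup>+s\<in>{0<..<x}. ennreal (u s) \<partial>lborel"
  assumes p: "1 < p" and [measurable]: "u \<in> borel_measurable borel"
    and nonneg: "\<And>s. 0 \<le> u s" and decr: "\<And>s t. 0 < s \<Longrightarrow> s \<le> t \<Longrightarrow> u t \<le> u s"
    and fin: "\<And>x. G x < top" and x: "0 < x"
  shows "(\<integral>\<^sup>+s\<in>{0<..<x}. ennreal (p * enn2real (G s) powr (p - 1) * u s) \<partial>lborel)
    = ennreal (enn2real (G x) powr p)"
proof -
  define g where "g x = enn2real (G x)" for x
  have Gg: "G x = ennreal (g x)" for x using fin[of x] by (simp add: g_def)
  have g0: "0 \<le> g x" for x by (simp add: g_def)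
  have "mono G"
    unfolding G_def by (intro monoI nn_integral_mono) (auto split: split_indicator)
  then have gmono: "g x \<le> g y" if "x \<le> y" for x y
    using that fin[of y] by (auto simp: g_def mono_def intro: enn2real_mono)
  have [measurable]: "g \<in> borel_measurable borel"
    using gmono by (intro borel_measurable_mono monoI)
  define v where "v s = p * g s powr (p - 1) * u s" for s
  have [measurable]: "v \<in> borel_measurable borel" unfolding v_def by measurable
  define P where "P x = (\<integral>\<^sup>+s\<in>{0<..<x}. ennreal (v s) \<partial>lborel)" for x
  \<comment> \<open>A crude bound, replacing g(s) by the larger g(x). It yields finiteness of
    \<open>P\<close> here and, at the end, its decay at 0.\<close>
  have Ple: "P x \<le> ennreal (p * g x powr p)" if "0 < x" for x
  proof -
    have "P x \<le> (\<integral>\<^sup>+s. ennreal (p * g x powr (p - 1)) * (ennreal (u s) * indicator {0<..<x} s) \<partial>lborel)"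
      unfolding P_def v_def using p nonneg g0 gmono
      by (intro nn_integral_mono)
        (auto split: split_indicator simp flip: ennreal_mult intro!: ennreal_leI mult_right_mono mult_left_mono powr_mono2)
    also have "\<dots> = ennreal (p * g x powr (p - 1)) * G x"
      unfolding G_def by (rule nn_integral_cmult) simp
    also have "\<dots> = ennreal (p * (g x powr (p - 1) * g x))"
      using p g0 by (simp add: Gg mult.assoc flip: ennreal_mult)
    also have "g x powr (p - 1) * g x = g x powr p"
      using g0[of x] by (cases "g x = 0") (simp_all add: powr_mult_base mult.commute)
    finally show ?thesis .
  qed
  have Pfin: "P x < top" if "0 < x" for x
    using Ple[OF that] by (rule le_less_trans) simp
  define H where "H x = g x powr p - enn2real (P x)" for x
  \<comment> \<open>An increment of this \<open>\<kappa>\<close> is p times the sum of u(a) times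
    the growth of g^(p-1) and g(b)^(p-1) times the drop of u. It thus dominates the oscillation of
    the product g^(p-1) u, with the other factor bounded uniformly on [a, b].\<close>
  have const: "H b = H a" if ab: "0 < a" "a \<le> b" for a b
  proof (rule constant_if_increments_small[OF ab(2),
      where \<kappa> = "\<lambda>x. p * (u a * g x powr (p - 1) - g b powr (p - 1) * u x)"])
    fix x y assume xy: "a \<le> x" "x \<le> y" "y \<le> b"
    \<comment> \<open>The increments of g^p and of \<open>P\<close> over [x, y] both lie between
      \<open>l\<close> and \<open>r\<close>: one factor is evaluated at its smallest, respectively
      largest, endpoint value. Hence the increment of their difference \<open>H\<close> is at most r
      - l.\<close>
    define l where "l = p * g x powr (p - 1) * u y * (y - x)"
    define r where "r = p * g y powr (p - 1) * u x * (y - x)"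
    have x0: "0 < x" using ab xy by simp
    have wmono: "g s powr (p - 1) \<le> g t powr (p - 1)" if "s \<le> t" for s t
      using that p g0 gmono by (intro powr_mono2) auto
    have gb: "u y * (y - x) \<le> g y - g x" "g y - g x \<le> u x * (y - x)"
      using nn_integral_increment_bounds[of u x y "u y" "u x"] x0 xy decr nonneg fin[of y]
      by (auto simp: g_def G_def)
    have "u y * p * g x powr (p - 1) \<le> v s \<and> v s \<le> u x * p * g y powr (p - 1)" if "x \<le> s" "s < y" for s
      unfolding v_def using that x0 p nonneg g0 decr[of s y] decr[of x s] wmono[of x s] wmono[of s y]
      by (auto intro!: mult_mono simp: mult.commute mult.left_commute)
    then have vb: "l \<le> enn2real (P y) - enn2real (P x)" "enn2real (P y) - enn2real (P x) \<le> r"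
      unfolding P_def l_def r_def
      using nn_integral_increment_bounds[of v x y "u y * p * g x powr (p - 1)" "u x * p * g y powr (p - 1)"]
        x0 xy Pfin[of y] p nonneg
      by (auto simp: P_def mult_ac)
    have "l \<le> p * g x powr (p - 1) * (g y - g x)"
      unfolding l_def mult.assoc[of _ "u y"] using p gb by (intro mult_left_mono) auto
    also have "\<dots> \<le> g y powr p - g x powr p"
      using p g0 gmono xy by (intro powr_diff_bounds) auto
    finally have lw: "l \<le> g y powr p - g x powr p" .
    have "g y powr p - g x powr p \<le> p * g y powr (p - 1) * (g y - g x)"
      using p g0 gmono xy by (intro powr_diff_bounds) auto
    also have "\<dots> \<le> r"
      unfolding r_def mult.assoc[of _ "u x"] using p gb by (intro mult_left_mono) auto
    finally have up: "g y powr p - g x powr p \<le> r" .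
    have "\<bar>H y - H x\<bar> \<le> r - l" using lw up vb unfolding H_def by linarith
    also have "r - l = p * (g y powr (p - 1) * (u x - u y) + u y * (g y powr (p - 1) - g x powr (p - 1))) * (y - x)"
      unfolding r_def l_def by (simp add: algebra_simps)
    also have "\<dots> \<le> p * (g b powr (p - 1) * (u x - u y) + u a * (g y powr (p - 1) - g x powr (p - 1))) * (y - x)"
      using p x0 xy ab decr wmono by (intro mult_right_mono mult_left_mono add_mono) auto
    finally show "\<bar>H y - H x\<bar> \<le> (p * (u a * g y powr (p - 1) - g b powr (p - 1) * u y) -
        p * (u a * g x powr (p - 1) - g b powr (p - 1) * u x)) * (y - x)"
      by (simp add: algebra_simps)
  qed
  \<comment> \<open>\<open>H\<close> is constant, so it suffices to make it small near 0. Both terms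
    of H(y) lie between 0 and p g(y)^p, and \<open>d\<close> solves p d^p = e.\<close>
  have "\<bar>H x\<bar> \<le> e" if "0 < e" for e
  proof -
    define d where "d = (e / p) powr (1 / p)"
    have d: "0 < d" "p * d powr p = e" using that p by (auto simp: d_def powr_powr)
    obtain y0 where y0: "0 < y0" "G y0 < ennreal d"
      using nn_integral_initial_small[of "\<lambda>s. ennreal (u s)" "ennreal d"] d(1) fin[of 1]
      by (auto simp: G_def)
    define y where "y = min x y0"
    have y: "0 < y" "y \<le> x" using y0 x by (auto simp: y_def)
    have "g y \<le> g y0" by (intro gmono) (simp add: y_def)
    also have "g y0 \<le> d" using y0 g0[of y0] by (simp add: Gg ennreal_less_iff)
    finally have "p * g y powr p \<le> e"
      unfolding d(2)[symmetric] using p g0 by (intro mult_left_mono powr_mono2) auto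
    moreover have "enn2real (P y) \<le> p * g y powr p"
      using Ple[OF y(1)] p by (intro enn2real_leI) auto
    moreover have "g y powr p \<le> p * g y powr p" using p mult_right_mono[of 1 p "g y powr p"] by auto
    moreover have "0 \<le> g y powr p" "0 \<le> enn2real (P y)" by auto
    ultimately have "\<bar>H y\<bar> \<le> e" unfolding H_def by linarith
    then show ?thesis using const[OF y] by simp
  qed
  then have "H x = 0" by (meson abs_le_zero_iff dense_ge)
  then have "enn2real (P x) = g x powr p" by (simp add: H_def)
  then have "P x = ennreal (g x powr p)"
    using Pfin[OF x] by (metis ennreal_enn2real)
  then show ?thesis by (simp add: P_def v_def g_def)
qed

text \<open>The preceding lemma for the constant function 1, whose primitive is
  \<open>max 0 y\<close>.\<close>

lemma nn_integral_powr_primitive: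
  assumes "1 < p" "0 < x"
  shows "(\<integral>\<^sup>+s\<in>{0<..<x}. ennreal (p * s powr (p - 1)) \<partial>lborel) = ennreal (x powr p)"
proof -
  have eq: "(\<integral>\<^sup>+s\<in>{0<..<y}. ennreal 1 \<partial>lborel) = ennreal (max 0 y)" for y :: real
    by (simp add: max_def)
  have "(\<integral>\<^sup>+s\<in>{0<..<x}. ennreal (p * s powr (p - 1)) \<partial>lborel)
      = (\<integral>\<^sup>+s\<in>{0<..<x}. ennreal (p * enn2real (ennreal (max 0 s)) powr (p - 1) * 1) \<partial>lborel)"
    by (intro nn_integral_cong) (auto split: split_indicator)
  also have "\<dots> = ennreal (enn2real (ennreal (max 0 x)) powr p)"
    using powr_primitive_of_decreasing[of p "\<lambda>_. 1" x] assms unfolding eq by simp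
  finally show ?thesis using assms by simp
qed

text \<open>Rewriting p g^(p-1) u as p s^(p-1) m(s) with m(s) = u(s) (g(s)/s)^(p-1) isolates a fixed
  power weight from a profile that depends on \<open>u\<close>. The profile decreases because both
  \<open>u\<close> and its average do.\<close>

lemma average_powr_profile:
  fixes u :: "real \<Rightarrow> real" and p :: real
  defines "G \<equiv> \<lambda>x. \<integral>\<^sup>+s\<in>{0<..<x}. ennreal (u s) \<partial>lborel"
  assumes p: "1 < p" and [measurable]: "u \<in> borel_measurable borel"
    and nonneg: "\<And>s. 0 \<le> u s" and decr: "\<And>s t. 0 < s \<Longrightarrow> s \<le> t \<Longrightarrow> u t \<le> u s"
    and fin: "\<And>x. G x < top"
  obtains m where "m \<in> borel_measurable borel" "\<And>s. 0 \<le> m s"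
    "\<And>s t. 0 < s \<Longrightarrow> s \<le> t \<Longrightarrow> m t \<le> m s"
    "\<And>x. 0 < x \<Longrightarrow> epowr (G x / ennreal x) p
      = ennreal (x powr - p) * (\<integral>\<^sup>+s\<in>{0<..<x}. ennreal (p * s powr (p - 1) * m s) \<partial>lborel)"
proof -
  define g where "g x = enn2real (G x)" for x
  have Gg: "G x = ennreal (g x)" for x using fin[of x] by (simp add: g_def)
  have g0: "0 \<le> g x" for x by (simp add: g_def)
  have "mono G"
    unfolding G_def by (intro monoI nn_integral_mono) (auto split: split_indicator)
  then have "g x \<le> g y" if "x \<le> y" for x y
    using that fin[of y] by (auto simp: g_def mono_def intro: enn2real_mono)
  then have [measurable]: "g \<in> borel_measurable borel"
    by (intro borel_measurable_mono monoI)
  \<comment> \<open>The average over (0, s) is at least u(s), while on [s, t) the function is at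
    most u(s); extending the interval cannot raise the average.\<close>
  have gdecr: "g t / t \<le> g s / s" if st: "0 < s" "s \<le> t" for s t
  proof -
    have "ennreal (u s) * emeasure lborel {0<..<s} \<le> G s"
      unfolding G_def using decr
      by (subst nn_integral_cmult_indicator[symmetric])
        (auto intro!: nn_integral_mono ennreal_leI split: split_indicator)
    then have gs: "u s * s \<le> g s"
      using st nonneg g0 by (simp add: Gg ennreal_le_iff flip: ennreal_mult)
    have "g t - g s \<le> u s * (t - s)"
      using nn_integral_increment_bounds[of u s t "u t" "u s"] st decr nonneg fin[of t]
      by (auto simp: g_def G_def)
    then have "(g t - g s) * s \<le> u s * (t - s) * s" using st by (intro mult_right_mono) auto
    also have "\<dots> = u s * s * (t - s)" by simp
    also have "\<dots> \<le> g s * (t - s)" using gs st by (intro mult_right_mono) auto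
    finally have "g t * s \<le> g s * t" by (simp add: algebra_simps)
    then show ?thesis using st by (simp add: field_simps)
  qed
  define m where "m s = u s * (g s / s) powr (p - 1)" for s
  have "m t \<le> m s" if "0 < s" "s \<le> t" for s t
    unfolding m_def using that decr gdecr p g0 nonneg
    by (intro mult_mono powr_mono2) auto
  moreover have "epowr (G x / ennreal x) p
      = ennreal (x powr - p) * (\<integral>\<^sup>+s\<in>{0<..<x}. ennreal (p * s powr (p - 1) * m s) \<partial>lborel)"
    if x: "0 < x" for x
  proof -
    have "(\<integral>\<^sup>+s\<in>{0<..<x}. ennreal (p * s powr (p - 1) * m s) \<partial>lborel)
      = (\<integral>\<^sup>+s\<in>{0<..<x}. ennreal (p * g s powr (p - 1) * u s) \<partial>lborel)"
      using g0 by (intro nn_integral_cong) (auto simp: m_def powr_divide mult_ac split: split_indicator)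
    also have "\<dots> = ennreal (g x powr p)"
      using powr_primitive_of_decreasing[OF p _ nonneg decr fin[unfolded G_def] x]
      by (simp add: g_def G_def)
    finally show ?thesis
      using x g0 p by (simp add: Gg divide_ennreal epowr_ennreal powr_divide powr_minus_divide flip: ennreal_mult)
  qed
  moreover have "m \<in> borel_measurable borel" unfolding m_def by measurable
  moreover have "0 \<le> m s" for s using nonneg by (simp add: m_def)
  ultimately show ?thesis by (intro that)
qed

subsection \<open>Layer-cake decomposition\<close>

text \<open>Writing m(s) as the length of the interval (0, m(s)) and exchanging integrals makes
  \<open>V\<close> an integral over levels l of kernels \<open>K l\<close>. On x > 0 each kernel is
  0, 1 or min(1, a/x)^p. The assumption on \<open>D\<close> handles every level with the same
  \<open>C\<close>, and integration over l keeps it.\<close>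

lemma decreasing_profile_dilation_bound:
  fixes m :: "real \<Rightarrow> real" and \<psi> :: "real \<Rightarrow> ennreal" and p t :: real
  defines "V \<equiv> \<lambda>x. ennreal (x powr - p) * (\<integral>\<^sup>+s\<in>{0<..<x}. ennreal (p * s powr (p - 1) * m s) \<partial>lborel)"
  defines "D \<equiv> \<lambda>a. \<integral>\<^sup>+x. ennreal (min 1 (a / x) powr p) * \<psi> x \<partial>lborel"
  assumes p: "1 < p" and t: "0 < t"
    and [measurable]: "m \<in> borel_measurable borel" "\<psi> \<in> borel_measurable borel"
    and nonneg: "\<And>s. 0 \<le> m s" and decr: "\<And>r s. 0 < r \<Longrightarrow> r \<le> s \<Longrightarrow> m s \<le> m r"
    and \<psi>0: "\<And>x. x \<le> 0 \<Longrightarrow> \<psi> x = 0"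
    and C: "\<And>a. 0 < a \<Longrightarrow> D (a * t) \<le> C * D a"
  shows "(\<integral>\<^sup>+x. V (x / t) * \<psi> x \<partial>lborel) \<le> C * (\<integral>\<^sup>+x. V x * \<psi> x \<partial>lborel)"
proof -
  \<comment> \<open>Membership in the two intervals is spelled out by \<open>if\<close>, so that
    joint measurability in l and x reduces to measurable comparisons.\<close>
  define K where "K l x = ennreal (x powr - p) * (\<integral>\<^sup>+s. ennreal (p * s powr (p - 1)) *
    (if 0 < s \<and> s < x then 1 else 0) * (if 0 < l \<and> l < m s then 1 else 0) \<partial>lborel)" for l x
  have K_meas: "(\<lambda>(l, x). K l x) \<in> borel_measurable (lborel \<Otimes>\<^sub>M lborel)"
    unfolding K_def by measurable
  have V_eq: "V x = (\<integral>\<^sup>+l. K l x \<partial>lborel)" for x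
  proof -
    have "ennreal (m s) = (\<integral>\<^sup>+l. indicator {0<..<m s} l \<partial>lborel)" for s
      using nonneg by simp
    then have layer: "ennreal (m s) = (\<integral>\<^sup>+l. (if 0 < l \<and> l < m s then 1 else 0) \<partial>lborel)" for s
      by (simp add: indicator_def of_bool_def)
    have "ennreal (p * s powr (p - 1) * m s) * indicator {0<..<x} s = (\<integral>\<^sup>+l. ennreal (p * s powr (p - 1)) *
       (if 0 < s \<and> s < x then 1 else 0) * (if 0 < l \<and> l < m s then 1 else 0) \<partial>lborel)" for s
      using p nonneg
      by (subst nn_integral_cmult) (auto simp: layer[symmetric] ennreal_mult split: split_indicator)
    then have "V x = ennreal (x powr - p) * (\<integral>\<^sup>+s. \<integral>\<^sup>+l. ennreal (p * s powr (p - 1)) *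
       (if 0 < s \<and> s < x then 1 else 0) * (if 0 < l \<and> l < m s then 1 else 0) \<partial>lborel \<partial>lborel)"
      unfolding V_def by simp
    also have "\<dots> = ennreal (x powr - p) * (\<integral>\<^sup>+l. \<integral>\<^sup>+s. ennreal (p * s powr (p - 1)) *
       (if 0 < s \<and> s < x then 1 else 0) * (if 0 < l \<and> l < m s then 1 else 0) \<partial>lborel \<partial>lborel)"
      by (intro arg_cong2[where f = "(*)"] refl lborel_pair.Fubini') measurable
    also have "\<dots> = (\<integral>\<^sup>+l. K l x \<partial>lborel)"
      unfolding K_def by (rule nn_integral_cmult[symmetric]) measurable
    finally show ?thesis .
  qed
  have level: "(\<integral>\<^sup>+x. K l (x / t) * \<psi> x \<partial>lborel) \<le> C * (\<integral>\<^sup>+x. K l x * \<psi> x \<partial>lborel)" for l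
  proof -
    \<comment> \<open>The superlevel set of \<open>m\<close> at level l, empty when l is not
      positive. Since \<open>m\<close> decreases, \<open>S\<close> is an initial segment of the
      half-line, which leaves three cases: empty, everything, or bounded and nonempty.\<close>
    define S where "S = {s. 0 < s \<and> 0 < l \<and> l < m s}"
    have K_S: "K l x = ennreal (x powr - p) *
        (\<integral>\<^sup>+s\<in>{0<..<x} \<inter> S. ennreal (p * s powr (p - 1)) \<partial>lborel)" for x
      unfolding K_def S_def
      by (rule arg_cong2[where f = "(*)", OF refl nn_integral_cong]) (auto split: split_indicator)
    have down: "r \<in> S" if "s \<in> S" "0 < r" "r \<le> s" for r s
      using that decr[of r s] by (auto simp: S_def)
    consider "S = {}" | "S = {0<..}" | s0 s1 where "s0 \<in> S" "0 < s1" "s1 \<notin> S"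
      by (auto simp: S_def)
    then show ?thesis
    proof cases
      case 1
      then show ?thesis by (simp add: K_S)
    next
      case 2
      have K1: "K l x = 1" if "0 < x" for x
      proof -
        have "{0<..<x} \<inter> {0<..} = {0<..<x}" by auto
        then show ?thesis
          using that p by (simp add: K_S 2 nn_integral_powr_primitive powr_minus flip: ennreal_mult)
      qed
      have K\<psi>: "K l x * \<psi> x = \<psi> x" "K l (x / t) * \<psi> x = \<psi> x" for x
        using \<psi>0[of x] K1 t by (cases "0 < x"; simp)+
      \<comment> \<open>An unbounded level set corresponds to an infinite a, reached as a limit:
        \<open>h n\<close> is the integrand of \<open>D (a n * t)\<close> and increases to
        \<open>\<psi>\<close>. Starting at 1 keeps \<open>a n\<close> positive, as the bound on
        \<open>D\<close> requires.\<close>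
      define a where "a n = real (Suc n)" for n
      define h where "h n x = ennreal (min 1 (a n * t / x) powr p) * \<psi> x" for n x
      have h_meas: "h n \<in> borel_measurable borel" for n unfolding h_def by measurable
      have "incseq h"
      proof (intro incseq_SucI le_funI)
        fix n x
        show "h n x \<le> h (Suc n) x"
        proof (cases "0 < x")
          case True
          then have "min 1 (a n * t / x) \<le> min 1 (a (Suc n) * t / x)"
            using t by (intro min.mono divide_right_mono mult_right_mono) (auto simp: a_def)
          then show ?thesis
            unfolding h_def using True t p
            by (intro mult_right_mono ennreal_leI powr_mono2) (auto simp: a_def)
        qed (simp add: h_def \<psi>0)
      qed
      moreover have "(SUP n. h n x) = \<psi> x" for x
      proof (cases "0 < x")
        case True
        obtain n where "x / t < real n" using reals_Archimedean2 by blast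
        then have "1 \<le> a n * t / x" using True t by (simp add: a_def field_simps)
        then have "h n x = \<psi> x" by (simp add: h_def)
        moreover have "h i x \<le> \<psi> x" for i
        proof -
          have "min 1 (a i * t / x) powr p \<le> 1 powr p"
            using True t p by (intro powr_mono2) (auto simp: a_def)
          then have "h i x \<le> ennreal 1 * \<psi> x"
            unfolding h_def by (intro mult_right_mono ennreal_leI) auto
          then show ?thesis by simp
        qed
        ultimately show ?thesis by (intro antisym SUP_least) (auto intro: SUP_upper2[of n])
      qed (simp add: h_def \<psi>0)
      ultimately have "(\<integral>\<^sup>+x. \<psi> x \<partial>lborel) = (SUP n. \<integral>\<^sup>+x. h n x \<partial>lborel)"
        using nn_integral_monotone_convergence_SUP[of h lborel] h_meas by simp
      also have "\<dots> = (SUP n. D (a n * t))" by (simp add: D_def h_def)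
      also have "\<dots> \<le> C * (\<integral>\<^sup>+x. \<psi> x \<partial>lborel)"
      proof (rule SUP_least)
        fix n
        have "min 1 (a n / x) powr p \<le> 1" if "0 < x" for x
          using that p powr_mono2[of p "min 1 (a n / x)" 1] by (simp add: a_def)
        then have "ennreal (min 1 (a n / x) powr p) * \<psi> x \<le> ennreal 1 * \<psi> x" for x
          using \<psi>0[of x] mult_right_mono[OF ennreal_leI, of _ 1 "\<psi> x"] by (cases "0 < x") auto
        then have "D (a n) \<le> (\<integral>\<^sup>+x. \<psi> x \<partial>lborel)"
          unfolding D_def by (intro nn_integral_mono) simp
        moreover have "D (a n * t) \<le> C * D (a n)" by (intro C) (simp add: a_def)
        ultimately show "D (a n * t) \<le> C * (\<integral>\<^sup>+x. \<psi> x \<partial>lborel)"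
          by (meson mult_left_mono order_trans zero_le)
      qed
      finally show ?thesis by (simp add: K\<psi>)
    next
      case 3
      \<comment> \<open>\<open>S\<close> is (0, a) or (0, a]. The undecided endpoint is a null set,
        so the kernel depends on a only.\<close>
      define a where "a = Sup S"
      have bdd: "bdd_above S"
        using 3 down by (intro bdd_aboveI[of _ s1]) (force simp: S_def)
      have a: "0 < a"
        using cSup_upper[OF 3(1) bdd] 3(1) by (auto simp: a_def S_def)
      have below: "s \<in> S" if "0 < s" "s < a" for s
        using that less_cSup_iff[of S s] bdd 3(1) down by (force simp: a_def)
      have above: "s \<le> a" if "s \<in> S" for s
        using cSup_upper[OF that bdd] by (simp add: a_def)
      have K_a: "K l x = ennreal (min 1 (a / x) powr p)" if x: "0 < x" for x
      proof -
        have "(\<integral>\<^sup>+s\<in>{0<..<x} \<inter> S. ennreal (p * s powr (p - 1)) \<partial>lborel)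
          = (\<integral>\<^sup>+s\<in>{0<..<min x a}. ennreal (p * s powr (p - 1)) \<partial>lborel)"
        proof (rule nn_integral_cong_AE)
          show "AE s in lborel. ennreal (p * s powr (p - 1)) * indicator ({0<..<x} \<inter> S) s
              = ennreal (p * s powr (p - 1)) * indicator {0<..<min x a} s"
            using AE_lborel_singleton[of a]
          proof eventually_elim
            case (elim s)
            with below[of s] above[of s] show ?case by (auto split: split_indicator)
          qed
        qed
        also have "\<dots> = ennreal (min x a powr p)"
          using p x a by (intro nn_integral_powr_primitive) auto
        finally have "K l x = ennreal (x powr - p * min x a powr p)"
          by (simp add: K_S ennreal_mult)
        also have "x powr - p * min x a powr p = (min x a / x) powr p"
          using x a by (simp add: powr_divide powr_minus_divide)
        also have "min x a / x = min 1 (a / x)"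
          using x by (simp add: min_def)
        finally show ?thesis .
      qed
      have "(\<integral>\<^sup>+x. K l (x / t) * \<psi> x \<partial>lborel) = D (a * t)"
        unfolding D_def
      proof (rule nn_integral_cong)
        fix x
        show "K l (x / t) * \<psi> x = ennreal (min 1 (a * t / x) powr p) * \<psi> x"
          using K_a[of "x / t"] t \<psi>0[of x] by (cases "0 < x") auto
      qed
      moreover have "(\<integral>\<^sup>+x. K l x * \<psi> x \<partial>lborel) = D a"
        unfolding D_def
      proof (rule nn_integral_cong)
        fix x
        show "K l x * \<psi> x = ennreal (min 1 (a / x) powr p) * \<psi> x"
          using K_a[of x] \<psi>0[of x] by (cases "0 < x") auto
      qed
      ultimately show ?thesis using C[OF a] by simp
    qed
  qed
  have swap: "(\<integral>\<^sup>+x. V (x / c) * \<psi> x \<partial>lborel) = (\<integral>\<^sup>+l. \<integral>\<^sup>+x. K l (x / c) * \<psi> x \<partial>lborel \<partial>lborel)" for c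
  proof -
    have [measurable]: "(\<lambda>y. K (fst y) (snd y / c)) \<in> borel_measurable (lborel \<Otimes>\<^sub>M lborel)"
      using measurable_compose[OF _ K_meas, of "\<lambda>y. (fst y, snd y / c)"] by simp
    have [measurable]: "(\<lambda>l. K l y) \<in> borel_measurable lborel" for y
      unfolding K_def by measurable
    have "(\<integral>\<^sup>+x. V (x / c) * \<psi> x \<partial>lborel) = (\<integral>\<^sup>+x. \<integral>\<^sup>+l. K l (x / c) * \<psi> x \<partial>lborel \<partial>lborel)"
      unfolding V_eq by (intro nn_integral_cong nn_integral_multc[symmetric]) measurable
    also have "\<dots> = (\<integral>\<^sup>+l. \<integral>\<^sup>+x. K l (x / c) * \<psi> x \<partial>lborel \<partial>lborel)"
      by (rule lborel_pair.Fubini') (simp add: split_beta')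
    finally show ?thesis .
  qed
  have "(\<integral>\<^sup>+x. V (x / t) * \<psi> x \<partial>lborel) \<le> (\<integral>\<^sup>+l. C * (\<integral>\<^sup>+x. K l x * \<psi> x \<partial>lborel) \<partial>lborel)"
    unfolding swap by (intro nn_integral_mono level)
  also have "\<dots> = C * (\<integral>\<^sup>+l. \<integral>\<^sup>+x. K l x * \<psi> x \<partial>lborel \<partial>lborel)"
  proof (rule nn_integral_cmult)
    have "(\<lambda>(l, x). K l x * \<psi> x) \<in> borel_measurable (lborel \<Otimes>\<^sub>M lborel)"
      using K_meas by (simp add: split_beta')
    then show "(\<lambda>l. \<integral>\<^sup>+x. K l x * \<psi> x \<partial>lborel) \<in> borel_measurable lborel"
      by (rule lborel.borel_measurable_nn_integral)
  qed
  also have "(\<integral>\<^sup>+l. \<integral>\<^sup>+x. K l x * \<psi> x \<partial>lborel \<partial>lborel) = (\<integral>\<^sup>+x. V x * \<psi> x \<partial>lborel)"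
    using swap[of 1] by simp
  finally show ?thesis .
qed

subsection \<open>Rearrangements and dilations\<close>

lemma rearr_antimono: "s \<le> t \<Longrightarrow> rearr f t \<le> rearr f s"
  unfolding rearr_def by (intro Inf_superset_mono) (auto intro: order_trans ennreal_leI)

lemma rearr_indicator:
  assumes "0 < a" "0 < s"
  shows "rearr (indicator {0<..<a}) s = (if s < a then 1 else 0)"
proof -
  have "{x \<in> {0<..}. l < (indicator {0<..<a} x :: ennreal)} = (if l < 1 then {0<..<a} else {})" for l :: ennreal
    using assms by (auto split: split_indicator_asm split_indicator simp: not_less not_le)
  then have set: "{l. 0 < l \<and> emeasure lebesgue {x \<in> {0<..}. (indicator {0<..<a} x :: ennreal) > l} \<le> ennreal s}
      = (if s < a then {1..} else {0<..})"
    using assms by (auto simp: ennreal_le_iff not_less intro: less_le_trans[of 0 1])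
  have "Inf {(0::ennreal)<..} = 0"
    by (rule Inf_greaterThan)
  then show ?thesis unfolding rearr_def set by auto
qed

text \<open>This is the source of min(1, a/x): the p-th power of this average, integrated against
  the weight, is D(a).\<close>

lemma max_rearr_indicator:
  assumes "0 < a" "0 < x"
  shows "max_rearr (indicator {0<..<a}) x = ennreal (min 1 (a / x))"
proof -
  have "(\<integral>\<^sup>+s\<in>{0<..<x}. rearr (indicator {0<..<a}) s \<partial>lborel) = (\<integral>\<^sup>+s. indicator {0<..<min x a} s \<partial>lborel)"
    by (intro nn_integral_cong) (auto simp: rearr_indicator assms(1) split: split_indicator)
  also have "\<dots> = ennreal (min x a)" using assms by simp
  finally have "max_rearr (indicator {0<..<a}) x = ennreal (min x a / x)"
    using assms by (simp add: max_rearr_def nn_integral_completion divide_ennreal)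
  also have "min x a / x = min 1 (a / x)" using assms by (simp add: min_def)
  finally show ?thesis .
qed

text \<open>Superlevel sets of the dilated function are those of \<open>f\<close> stretched by t, so
  their measure is multiplied by t, and comparing it with x amounts to comparing the original
  measure with x/t.\<close>

lemma rearr_dilation:
  assumes f: "f \<in> M_plus" and "0 < t"
  shows "rearr (dilation (1 / t) f) x = rearr f (x / t)"
proof -
  have "emeasure lebesgue {x \<in> {0<..}. dilation (1 / t) f x > l} = ennreal t * emeasure lebesgue {x \<in> {0<..}. f x > l}" for l
  proof -
    have "{x \<in> space (lebesgue_on {0<..}). f x > l} \<in> sets (lebesgue_on {0<..})"
      using f unfolding M_plus_def by measurable
    then have A: "{x \<in> {0<..}. f x > l} \<in> sets lebesgue" (is "?A \<in> _")
      by (auto simp: sets_restrict_space_iff)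
    define B where "B = {x \<in> {0<..}. dilation (1 / t) f x > l}"
    have BA: "x \<in> B \<longleftrightarrow> x / t \<in> ?A" for x
      using assms(2) by (simp add: B_def dilation_def zero_less_divide_iff)
    have "(\<lambda>x. (1 / t) *\<^sub>R x) -` ?A \<inter> space lebesgue \<in> sets lebesgue"
      using A by (rule measurable_sets[OF lebesgue_measurable_scaling])
    also have "(\<lambda>x. (1 / t) *\<^sub>R x) -` ?A \<inter> space lebesgue = B"
      using BA by auto
    finally have B: "B \<in> sets lebesgue" .
    have "emeasure lebesgue B = (\<integral>\<^sup>+x. indicator B x \<partial>lebesgue)" using B by simp
    also have "\<dots> = ennreal \<bar>t\<bar> * (\<integral>\<^sup>+x. indicator B (0 + t * x) \<partial>lebesgue)"
      using B assms(2) by (intro nn_integral_real_affine_lebesgue) auto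
    also have "(\<integral>\<^sup>+x. indicator B (0 + t * x) \<partial>lebesgue) = (\<integral>\<^sup>+x. indicator ?A x \<partial>lebesgue)"
      using assms(2) BA by (intro nn_integral_cong) (auto simp: indicator_def)
    finally show ?thesis using A assms(2) by (simp add: B_def)
  qed
  moreover have "ennreal t * e \<le> ennreal x \<longleftrightarrow> e \<le> ennreal (x / t)" for e
  proof (cases e)
    case (real r)
    then show ?thesis
      using assms(2) by (cases "0 \<le> x")
        (auto simp: ennreal_le_iff pos_le_divide_eq mult.commute ennreal_neg divide_nonpos_pos simp flip: ennreal_mult)
  next
    case top
    then show ?thesis using assms(2) by (simp add: ennreal_mult_top top_unique)
  qed
  ultimately show ?thesis unfolding rearr_def by simp
qed

text \<open>The weight is only Lebesgue measurable on the half-line, whereas the Fubini arguments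
  run over \<open>lborel\<close>. The truncations to (0, n+1) have a measurable supremum, which
  agrees almost everywhere with a Borel function; cutting it off on x \<le> 0 lets integrals over
  the half-line be taken over all reals.\<close>

lemma weight_borel_version:
  assumes "weight \<phi>"
  obtains \<psi> :: "real \<Rightarrow> ennreal" where "\<psi> \<in> borel_measurable borel" "\<And>x. x \<le> 0 \<Longrightarrow> \<psi> x = 0"
    "AE x in lborel. 0 < x \<longrightarrow> \<psi> x = ennreal (\<phi> x)"
proof -
  have int: "set_integrable lebesgue {0<..<t} \<phi>" if "t > 0" for t
    using assms that by (simp add: weight_def)
  have meas: "(\<lambda>x. ennreal (indicator {0<..<real (Suc n)} x *\<^sub>R \<phi> x)) \<in> borel_measurable lebesgue" for n
    using borel_measurable_integrable[OF int[unfolded set_integrable_def, of "real (Suc n)"]] by simp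
  define h where "h x = (SUP n. ennreal (indicator {0<..<real (Suc n)} x *\<^sub>R \<phi> x))" for x
  have "h \<in> borel_measurable lebesgue"
    unfolding h_def by (intro borel_measurable_SUP meas) auto
  then obtain h' where [measurable]: "h' \<in> borel_measurable lborel" and ae: "AE x in lborel. h x = h' x"
    using completion_ex_borel_measurable by blast
  have h: "h x = ennreal (\<phi> x)" if "0 < x" for x
  proof -
    obtain n where "x < real n" using reals_Archimedean2 by blast
    then have "x < real (Suc n)" by simp
    then show ?thesis
      unfolding h_def using that
      by (intro antisym SUP_least) (auto split: split_indicator intro!: SUP_upper2[of n])
  qed
  show ?thesis
  proof (rule that[of "\<lambda>x. h' x * indicator {0<..} x"])
    show "AE x in lborel. 0 < x \<longrightarrow> h' x * indicator {0<..} x = ennreal (\<phi> x)"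
      using ae by eventually_elim (auto simp: h)
  qed auto
qed

text \<open>Finiteness of f** at one point makes the rearrangement finite on the half-line and its
  primitive finite everywhere. The real-valued results then apply to it, and f** of the dilated
  function at x is f** of \<open>f\<close> at x/t.\<close>

lemma rho_dilation_le:
  fixes \<psi> :: "real \<Rightarrow> ennreal" and p t :: real
  defines "D \<equiv> \<lambda>a. \<integral>\<^sup>+x. ennreal (min 1 (a / x) powr p) * \<psi> x \<partial>lborel"
  defines "\<rho>p \<equiv> \<lambda>f. \<integral>\<^sup>+x. epowr (max_rearr f x) p * \<psi> x \<partial>lborel"
  assumes p: "1 < p" and t: "0 < t" and f: "f \<in> M_plus"
    and \<psi>: "\<psi> \<in> borel_measurable borel" "\<And>x. x \<le> 0 \<Longrightarrow> \<psi> x = 0"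
    and C: "\<And>a. 0 < a \<Longrightarrow> D (a * t) \<le> C * D a"
    and x0: "0 < x0" "max_rearr f x0 < top"
  shows "\<rho>p (dilation (1 / t) f) \<le> C * \<rho>p f"
proof -
  \<comment> \<open>An infinite value of the rearrangement at s would spread to all of (0, s] by
    monotonicity and make the integral over (0, x0) infinite.\<close>
  have int0: "(\<integral>\<^sup>+s\<in>{0<..<x0}. rearr f s \<partial>lborel) < top"
    using x0 by (auto simp: max_rearr_def nn_integral_completion ennreal_divide_eq_top_iff less_top[symmetric])
  have fin: "rearr f s < top" if "0 < s" for s
  proof (rule ccontr)
    assume "\<not> rearr f s < top"
    then have "rearr f s = top" by (simp add: less_top[symmetric])
    then have "(\<integral>\<^sup>+r. top * indicator {0<..<min s x0} r \<partial>lborel) \<le> (\<integral>\<^sup>+r\<in>{0<..<x0}. rearr f r \<partial>lborel)"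
      using rearr_antimono[of _ s f]
      by (intro nn_integral_mono) (auto split: split_indicator simp: top_unique)
    then show False
      using int0 that x0 by (subst (asm) nn_integral_cmult_indicator) (auto simp: ennreal_top_mult top_unique min_def split: if_splits)
  qed
  define u where "u s = (if 0 < s then enn2real (rearr f s) else 0)" for s
  have u: "ennreal (u s) = rearr f s" if "0 < s" for s
    using fin[OF that] that by (simp add: u_def)
  have u0: "0 \<le> u s" for s by (simp add: u_def)
  have udecr: "u r \<le> u s" if "0 < s" "s \<le> r" for s r
    unfolding u_def using that rearr_antimono[of s r f] fin[of s] by (auto intro: enn2real_mono)
  have u_meas: "u \<in> borel_measurable borel"
  proof -
    have "mono_on {0<..} (\<lambda>s. - u s)" by (intro mono_onI) (auto intro: udecr)
    then have "(\<lambda>s. - u s) \<in> borel_measurable (restrict_space borel {0<..})"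
      by (rule borel_measurable_mono_on_fnc)
    then have "(\<lambda>s. - (- u s)) \<in> borel_measurable (restrict_space borel {0<..})"
      by (rule borel_measurable_uminus)
    then show ?thesis
      by (subst (asm) borel_measurable_restrict_space_iff) (auto simp: u_def[abs_def] indicator_def of_bool_def if_distrib cong: if_cong)
  qed
  define G where "G x = (\<integral>\<^sup>+s\<in>{0<..<x}. ennreal (u s) \<partial>lborel)" for x
  have max_rearr: "max_rearr f x = G x / ennreal x" for x
    unfolding max_rearr_def G_def nn_integral_completion
    by (intro arg_cong2[where f = divide] nn_integral_cong) (auto simp: u split: split_indicator)
  \<comment> \<open>Below \<open>x0\<close> the integral is finite by assumption; from
    \<open>x0\<close> on, \<open>u\<close> is at most u(x0).\<close>
  have Gfin: "G x < top" for x
  proof -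
    have "G x \<le> (\<integral>\<^sup>+s. rearr f s * indicator {0<..<x0} s + ennreal (u x0) * indicator {0<..<x} s \<partial>lborel)"
      unfolding G_def using udecr[OF x0(1)]
      by (intro nn_integral_mono) (auto split: split_indicator simp: u[symmetric] intro!: ennreal_leI)
    also have "\<dots> = (\<integral>\<^sup>+s. ennreal (u s) * indicator {0<..<x0} s + ennreal (u x0) * indicator {0<..<x} s \<partial>lborel)"
      by (intro nn_integral_cong) (auto split: split_indicator simp: u)
    also have "\<dots> = (\<integral>\<^sup>+s. ennreal (u s) * indicator {0<..<x0} s \<partial>lborel) + ennreal (u x0) * emeasure lborel {0<..<x}"
      using u_meas by (subst nn_integral_add) (auto simp: nn_integral_cmult_indicator)
    also have "(\<integral>\<^sup>+s. ennreal (u s) * indicator {0<..<x0} s \<partial>lborel) = (\<integral>\<^sup>+s\<in>{0<..<x0}. rearr f s \<partial>lborel)"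
      by (intro nn_integral_cong) (auto simp: u split: split_indicator)
    finally show ?thesis
      using int0 by (cases "0 < x") (auto simp: ennreal_mult_less_top intro: le_less_trans)
  qed
  have dil: "max_rearr (dilation (1 / t) f) x = G (x / t) / ennreal (x / t)" if x: "0 < x" for x
  proof -
    have "(\<integral>\<^sup>+s\<in>{0<..<x}. rearr (dilation (1 / t) f) s \<partial>lborel)
      = (\<integral>\<^sup>+s. ennreal (u (s / t)) * indicator {0<..<x} s \<partial>lborel)"
      using t by (intro nn_integral_cong) (auto simp: rearr_dilation[OF f t] u split: split_indicator)
    also have "\<dots> = ennreal \<bar>t\<bar> * (\<integral>\<^sup>+s. ennreal (u ((0 + t * s) / t)) * indicator {0<..<x} (0 + t * s) \<partial>lborel)"
      using t measurable_compose[OF _ u_meas, of "\<lambda>s. s / t" borel] by (intro nn_integral_real_affine) auto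
    also have "(\<integral>\<^sup>+s. ennreal (u ((0 + t * s) / t)) * indicator {0<..<x} (0 + t * s) \<partial>lborel) = G (x / t)"
      unfolding G_def using t
      by (intro nn_integral_cong) (auto simp: field_simps zero_less_mult_iff split: split_indicator)
    finally show ?thesis
      using Gfin[of "x / t"] t x unfolding max_rearr_def nn_integral_completion
      by (cases "G (x / t)") (simp_all add: divide_ennreal mult.commute flip: ennreal_mult)
  qed
  obtain m where m: "m \<in> borel_measurable borel" "\<And>s. 0 \<le> m s"
    "\<And>s t. 0 < s \<Longrightarrow> s \<le> t \<Longrightarrow> m t \<le> m s"
    and eq: "\<And>x. 0 < x \<Longrightarrow> epowr (G x / ennreal x) p
      = ennreal (x powr - p) * (\<integral>\<^sup>+s\<in>{0<..<x}. ennreal (p * s powr (p - 1) * m s) \<partial>lborel)"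
    by (rule average_powr_profile[OF p u_meas u0 udecr Gfin[unfolded G_def], folded G_def]) (assumption | rule that)+
  define V where "V x = ennreal (x powr - p) * (\<integral>\<^sup>+s\<in>{0<..<x}. ennreal (p * s powr (p - 1) * m s) \<partial>lborel)" for x
  have "epowr (max_rearr (dilation (1 / t) f) x) p * \<psi> x = V (x / t) * \<psi> x" for x
    using \<psi>(2)[of x] t eq[of "x / t"] dil[of x] by (cases "0 < x") (auto simp: V_def)
  moreover have "epowr (max_rearr f x) p * \<psi> x = V x * \<psi> x" for x
    using \<psi>(2)[of x] eq[of x] by (cases "0 < x") (auto simp: V_def max_rearr)
  moreover have "(\<integral>\<^sup>+x. V (x / t) * \<psi> x \<partial>lborel) \<le> C * (\<integral>\<^sup>+x. V x * \<psi> x \<partial>lborel)"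
    unfolding V_def by (rule decreasing_profile_dilation_bound[OF p t m(1) \<psi>(1) m(2,3) \<psi>(2) C[unfolded D_def]])
  ultimately show ?thesis unfolding \<rho>p_def by simp
qed

section \<open>Norms of characteristic functions, equality of the dilation norm with
  \<open>M_fun\<close>, and the indices\<close>

theorem theorem5p2:
  fixes p :: real and \<phi> :: "real \<Rightarrow> real"
  assumes "1 < p" and "nontrivial_weight p \<phi>"
  shows "equivalent_on_pos (dilation_norm (rho p \<phi>)) (M_fun (rho p \<phi>)) \<and>
    equivalent_on_pos (M_fun (rho p \<phi>))
      (\<lambda>t. SUP s\<in>{0<..}. epowr
        (((\<integral>\<^sup>+y\<in>{0<..<s * t}. ennreal (\<phi> y) \<partial>lebesgue)
            + ennreal (s powr p * t powr p)
              * (\<integral>\<^sup>+y\<in>{s * t<..}. ennreal (\<phi> y * y powr (- p)) \<partial>lebesgue))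
         / ((\<integral>\<^sup>+y\<in>{0<..<s}. ennreal (\<phi> y) \<partial>lebesgue)
            + ennreal (s powr p)
              * (\<integral>\<^sup>+y\<in>{s<..}. ennreal (\<phi> y * y powr (- p)) \<partial>lebesgue)))
        (1 / p)) \<and>
    lower_Boyd (rho p \<phi>) = lower_fundamental (rho p \<phi>) \<and>
    upper_Boyd (rho p \<phi>) = upper_fundamental (rho p \<phi>)"
proof -
  have p: "1 < p" by fact
  have w: "weight \<phi>" and tail: "(\<integral>\<^sup>+t\<in>{1<..}. ennreal (\<phi> t * t powr (- p)) \<partial>lborel) < top"
    using assms(2) by (auto simp: nontrivial_weight_def nn_integral_completion)
  have pos: "0 < \<phi> x" if "0 < x" for x using w that by (simp add: weight_def)
  obtain \<psi> :: "real \<Rightarrow> ennreal" where [measurable]: "\<psi> \<in> borel_measurable borel"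
    and \<psi>0: "\<And>x. x \<le> 0 \<Longrightarrow> \<psi> x = 0" and \<psi>: "AE x in lborel. 0 < x \<longrightarrow> \<psi> x = ennreal (\<phi> x)"
    using weight_borel_version[OF w] by metis
  define D where "D a = (\<integral>\<^sup>+x. ennreal (min 1 (a / x) powr p) * \<psi> x \<partial>lborel)" for a
  define \<rho>p where "\<rho>p f = (\<integral>\<^sup>+x. epowr (max_rearr f x) p * \<psi> x \<partial>lborel)" for f
  have rho: "rho p \<phi> f = epowr (\<rho>p f) (1 / p)" for f
  proof -
    have "(\<integral>\<^sup>+t\<in>{0<..}. epowr (max_rearr f t) p * ennreal (\<phi> t) \<partial>lborel) = \<rho>p f"
      unfolding \<rho>p_def
    proof (rule nn_integral_cong_AE)
      show "AE x in lborel. epowr (max_rearr f x) p * ennreal (\<phi> x) * indicator {0<..} x = epowr (max_rearr f x) p * \<psi> x"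
        using \<psi> by eventually_elim (auto simp: \<psi>0 not_less split: split_indicator)
    qed
    then show ?thesis by (simp add: rho_def nn_integral_completion)
  qed
  have \<rho>p_ind: "\<rho>p (indicator {0<..<a}) = D a" if "0 < a" for a
    unfolding \<rho>p_def D_def
  proof (rule nn_integral_cong)
    fix x
    show "epowr (max_rearr (indicator {0<..<a}) x) p * \<psi> x = ennreal (min 1 (a / x) powr p) * \<psi> x"
      using that \<psi>0[of x] by (cases "0 < x") (auto simp: max_rearr_indicator epowr_ennreal)
  qed
  have low: "(\<integral>\<^sup>+y\<in>{0<..<a}. ennreal (\<phi> y) \<partial>lborel) = (\<integral>\<^sup>+y\<in>{0<..<a}. \<psi> y \<partial>lborel)" for a
    using \<psi> by (intro nn_integral_cong_AE) (auto elim!: eventually_mono split: split_indicator)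
  have high: "(\<integral>\<^sup>+y\<in>{a<..}. ennreal (\<phi> y * y powr (- p)) \<partial>lborel)
      = (\<integral>\<^sup>+y. ennreal (y powr (- p)) * \<psi> y * indicator {a<..} y \<partial>lborel)" if "0 < a" for a
    using \<psi> that pos
    by (intro nn_integral_cong_AE)
      (auto elim!: eventually_mono split: split_indicator simp: ennreal_mult less_imp_le mult.commute)
  \<comment> \<open>The factor min(1, a/y)^p is 1 below a and a^p y^(-p) above it. With this the
    ratio D(at)/D(a) becomes the quotient in the claim.\<close>
  have D_eq: "D a = (\<integral>\<^sup>+y\<in>{0<..<a}. ennreal (\<phi> y) \<partial>lborel)
      + ennreal (a powr p) * (\<integral>\<^sup>+y\<in>{a<..}. ennreal (\<phi> y * y powr (- p)) \<partial>lborel)" if a: "0 < a" for a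
  proof -
    have "D a = (\<integral>\<^sup>+y. \<psi> y * indicator {0<..<a} y
        + ennreal (a powr p) * (ennreal (y powr (- p)) * \<psi> y * indicator {a<..} y) \<partial>lborel)"
      unfolding D_def
    proof (rule nn_integral_cong_AE)
      show "AE y in lborel. ennreal (min 1 (a / y) powr p) * \<psi> y = \<psi> y * indicator {0<..<a} y
        + ennreal (a powr p) * (ennreal (y powr (- p)) * \<psi> y * indicator {a<..} y)"
        using AE_lborel_singleton[of a]
      proof eventually_elim
        case (elim y)
        consider "y \<le> 0" | "0 < y" "y < a" | "a < y" using elim by linarith
        then show ?case
        proof cases
          case 3
          then have "min 1 (a / y) powr p = a powr p * y powr (- p)"
            using a by (simp add: min_def powr_divide powr_minus_divide)
          then show ?thesis using 3 a by (simp add: ennreal_mult mult.assoc)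
        qed (use a in \<open>auto simp: \<psi>0 min_def\<close>)
      qed
    qed
    then show ?thesis using a by (simp add: nn_integral_add nn_integral_cmult low high)
  qed
  have Dfin: "D a < top" if a: "0 < a" for a
  proof -
    \<comment> \<open>With b = a + 1, every y \<ge> b exceeds both a, where the minimum equals a/y,
      and 1, where the tail condition applies. Below b local integrability suffices.\<close>
    define b where "b = a + 1"
    have b: "1 < b" "a < b" using a by (auto simp: b_def)
    have "set_integrable lebesgue {0<..<b} \<phi>" using w a b by (simp add: weight_def)
    then have "integrable lebesgue (\<lambda>x. indicator {0<..<b} x *\<^sub>R \<phi> x)" by (simp add: set_integrable_def)
    then have "(\<integral>\<^sup>+x. ennreal (norm (indicator {0<..<b} x *\<^sub>R \<phi> x)) \<partial>lebesgue) < \<infinity>"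
      by (simp add: integrable_iff_bounded)
    then have near: "(\<integral>\<^sup>+x\<in>{0<..<b}. ennreal (\<phi> x) \<partial>lborel) < top"
      using pos unfolding nn_integral_completion
      by (subst nn_integral_cong[where v = "\<lambda>x. ennreal (norm (indicator {0<..<b} x *\<^sub>R \<phi> x))"])
        (auto split: split_indicator simp: less_imp_le)
    have "D a \<le> (\<integral>\<^sup>+y. \<psi> y * indicator {0<..<b} y
        + ennreal (a powr p) * (ennreal (y powr (- p)) * \<psi> y * indicator {1<..} y) \<partial>lborel)"
      unfolding D_def
    proof (rule nn_integral_mono)
      fix y :: real
      consider "y \<le> 0" | "0 < y" "y < b" | "b \<le> y" by linarith
      then show "ennreal (min 1 (a / y) powr p) * \<psi> y \<le> \<psi> y * indicator {0<..<b} y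
        + ennreal (a powr p) * (ennreal (y powr (- p)) * \<psi> y * indicator {1<..} y)"
      proof cases
        case 2
        then have "min 1 (a / y) powr p \<le> 1"
          using a p powr_mono2[of p "min 1 (a / y)" 1] by simp
        then have "ennreal (min 1 (a / y) powr p) * \<psi> y \<le> ennreal 1 * \<psi> y"
          by (intro mult_right_mono ennreal_leI) auto
        then show ?thesis using 2 by (auto intro: order_trans)
      next
        case 3
        then have "min 1 (a / y) powr p = a powr p * y powr (- p)"
          using a b by (simp add: min_def powr_divide powr_minus_divide)
        then show ?thesis using 3 b by (simp add: ennreal_mult mult.assoc)
      qed (simp add: \<psi>0)
    qed
    also have "\<dots> = (\<integral>\<^sup>+y\<in>{0<..<b}. ennreal (\<phi> y) \<partial>lborel)
      + ennreal (a powr p) * (\<integral>\<^sup>+y\<in>{1<..}. ennreal (\<phi> y * y powr (- p)) \<partial>lborel)"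
      by (simp add: nn_integral_add nn_integral_cmult low high)
    also have "\<dots> < top" using near tail by (simp add: ennreal_mult_less_top)
    finally show ?thesis .
  qed
  \<comment> \<open>A vanishing integral would force its integrand to vanish almost everywhere, but
    it is positive at almost every point of (0, 1).\<close>
  have Dpos: "D a \<noteq> 0" if a: "0 < a" for a
  proof
    assume "D a = 0"
    then have "AE x in lborel. ennreal (min 1 (a / x) powr p) * \<psi> x = 0"
      unfolding D_def by (subst (asm) nn_integral_0_iff_AE) auto
    with \<psi> have "AE x in lborel. x \<notin> {0<..<1::real}"
    proof eventually_elim
      case (elim x)
      then show ?case using a pos[of x] by (auto simp: ennreal_eq_0_iff min_def split: if_splits)
    qed
    then have "emeasure lborel {0<..<1::real} = 0"
      by (subst (asm) AE_iff_measurable[of "{0<..<1}"]) auto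
    then show False by simp
  qed
  have M_eq: "M_fun (rho p \<phi>) t = (SUP a\<in>{0<..}. epowr (D (a * t) / D a) (1 / p))" if "0 < t" for t
    unfolding M_fun_def using p that
    by (intro SUP_cong) (auto simp: rho \<rho>p_ind epowr_divide)
  have norm_eq: "dilation_norm (rho p \<phi>) t = M_fun (rho p \<phi>) t" if t: "0 < t" for t
  proof (rule antisym)
    \<comment> \<open>The p-th power of M(t), possibly infinite, is by definition an admissible
      constant in D(at) \<le> C D(a). Dividing by D(a) and multiplying back is legitimate since D(a)
      is positive and finite.\<close>
    define C where "C = epowr (M_fun (rho p \<phi>) t) p"
    have CM: "epowr C (1 / p) = M_fun (rho p \<phi>) t"
      using p by (simp add: C_def epowr_epowr_inverse)
    have C: "D (a * t) \<le> C * D a" if a: "0 < a" for a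
    proof -
      have "epowr (D (a * t) / D a) (1 / p) \<le> M_fun (rho p \<phi>) t"
        unfolding M_eq[OF t] using a by (intro SUP_upper) auto
      then have "epowr (epowr (D (a * t) / D a) (1 / p)) p \<le> C"
        unfolding C_def using p by (intro epowr_mono) auto
      then have "D (a * t) / D a \<le> C" using p by (simp add: epowr_epowr_inverse)
      then have "D (a * t) / D a * D a \<le> C * D a" by (intro mult_right_mono) auto
      then show ?thesis using Dpos[OF a] Dfin[OF a] by (simp add: ennreal_divide_times ennreal_mult_divide_eq)
    qed
    show "dilation_norm (rho p \<phi>) t \<le> M_fun (rho p \<phi>) t"
      unfolding dilation_norm_def
    proof (rule Sup_least, clarify)
      fix f assume f: "f \<in> M_plus" "rho p \<phi> f < top"
      \<comment> \<open>If f** were infinite throughout, positivity of the weight would make the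
        norm of \<open>f\<close> infinite.\<close>
      have "\<exists>x0>0. max_rearr f x0 < top"
      proof (rule ccontr)
        assume "\<not> ?thesis"
        then have top: "max_rearr f x = top" if "0 < x" for x using that by (metis less_top)
        have "\<rho>p f = (\<integral>\<^sup>+x. top * indicator {0<..} (x::real) \<partial>lborel)"
          unfolding \<rho>p_def
        proof (rule nn_integral_cong_AE)
          show "AE x in lborel. epowr (max_rearr f x) p * \<psi> x = top * indicator {0<..} x"
            using \<psi>
          proof eventually_elim
            case (elim x)
            then show ?case
              using pos[of x] top[of x] \<psi>0[of x]
              by (cases "0 < x") (auto simp: epowr_def ennreal_top_mult ennreal_eq_0_iff)
          qed
        qed
        also have "\<dots> = top * emeasure lborel {0::real<..}" by (simp add: nn_integral_cmult_indicator)
        also have "\<dots> = top"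
          using emeasure_mono[of "{0<..<1}" "{0::real<..}" lborel] by (force simp: ennreal_top_mult subset_iff)
        finally show False using f(2) by (simp add: rho epowr_def)
      qed
      then obtain x0 where x0: "0 < x0" "max_rearr f x0 < top" by blast
      have "\<rho>p (dilation (1 / t) f) \<le> C * \<rho>p f"
        unfolding \<rho>p_def
        by (rule rho_dilation_le[OF p t f(1) _ \<psi>0 C[unfolded D_def] x0]) auto
      then have "epowr (\<rho>p (dilation (1 / t) f)) (1 / p) \<le> epowr (C * \<rho>p f) (1 / p)"
        using p by (intro epowr_mono) auto
      then have le: "rho p \<phi> (dilation (1 / t) f) \<le> M_fun (rho p \<phi>) t * rho p \<phi> f"
        using p by (simp add: rho epowr_mult CM)
      show "rho p \<phi> (dilation (1 / t) f) / rho p \<phi> f \<le> M_fun (rho p \<phi>) t"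
      \<comment> \<open>For a zero denominator, \<open>le\<close> forces the numerator to be zero as
        well, and 0/0 is 0 in \<open>ennreal\<close>.\<close>
      proof (cases "rho p \<phi> f = 0")
        case False
        have "rho p \<phi> (dilation (1 / t) f) / rho p \<phi> f \<le> M_fun (rho p \<phi>) t * rho p \<phi> f / rho p \<phi> f"
          using le by (rule divide_right_mono_ennreal)
        also have "\<dots> = M_fun (rho p \<phi>) t"
          using False f(2) by (intro ennreal_mult_divide_eq) auto
        finally show ?thesis .
      qed (use le in simp)
    qed
    \<comment> \<open>Characteristic functions of (0, a) are admissible in the supremum, and
      dilation turns them into those of (0, at).\<close>
    show "M_fun (rho p \<phi>) t \<le> dilation_norm (rho p \<phi>) t"
      unfolding M_fun_def
    proof (rule SUP_least)
      fix a :: real assume "a \<in> {0<..}"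
      then have a: "0 < a" by simp
      have "(indicator {0<..<a} :: real \<Rightarrow> ennreal) \<in> M_plus"
        unfolding M_plus_def by (intro measurable_restrict_space1 borel_measurable_indicator) simp
      moreover have "\<not> (AE x in lebesgue_on {0<..}. (indicator {0<..<a} x :: ennreal) = 0)"
      proof
        assume "AE x in lebesgue_on {0<..}. (indicator {0<..<a} x :: ennreal) = 0"
        then have "AE x in lebesgue. x \<notin> {0<..<a}"
          by (subst (asm) AE_restrict_space_iff) (auto elim!: eventually_mono split: split_indicator_asm)
        then have "emeasure lebesgue {0<..<a} = 0"
          by (subst (asm) AE_iff_measurable[of "{0<..<a}"]) auto
        then show False using a by simp
      qed
      moreover have "rho p \<phi> (indicator {0<..<a}) < top"
        using Dfin[OF a] by (simp add: rho \<rho>p_ind[OF a] epowr_def less_top)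
      moreover have dil: "dilation (1 / t) (indicator {0<..<a}) = (indicator {0<..<a * t} :: real \<Rightarrow> ennreal)"
        using t by (auto simp: dilation_def fun_eq_iff field_simps zero_less_mult_iff split: split_indicator)
      ultimately show "rho p \<phi> (indicator {0<..<a * t}) / rho p \<phi> (indicator {0<..<a})
          \<le> dilation_norm (rho p \<phi>) t"
        unfolding dilation_norm_def dil[symmetric] by (intro Sup_upper) blast
    qed
  qed
  have formula: "M_fun (rho p \<phi>) t = (SUP s\<in>{0<..}. epowr
        (((\<integral>\<^sup>+y\<in>{0<..<s * t}. ennreal (\<phi> y) \<partial>lebesgue)
            + ennreal (s powr p * t powr p)
              * (\<integral>\<^sup>+y\<in>{s * t<..}. ennreal (\<phi> y * y powr (- p)) \<partial>lebesgue))
         / ((\<integral>\<^sup>+y\<in>{0<..<s}. ennreal (\<phi> y) \<partial>lebesgue)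
            + ennreal (s powr p)
              * (\<integral>\<^sup>+y\<in>{s<..}. ennreal (\<phi> y * y powr (- p)) \<partial>lebesgue)))
        (1 / p))" if "0 < t" for t
    unfolding M_eq[OF that] using that
    by (intro SUP_cong refl) (simp add: D_eq nn_integral_completion powr_mult)
  \<comment> \<open>All three functions coincide for t > 0, so both equivalences hold with constants
    1; the indices agree because they are built from the same values.\<close>
  have "equivalent_on_pos F F'" if "\<And>t. 0 < t \<Longrightarrow> F t = F' t" for F F'
    unfolding equivalent_on_pos_def using that by (intro exI[of _ 1]) auto
  moreover have "lower_Boyd (rho p \<phi>) = lower_fundamental (rho p \<phi>)"
    unfolding lower_Boyd_def lower_fundamental_def by (intro SUP_cong) (auto simp: norm_eq)
  moreover have "upper_Boyd (rho p \<phi>) = upper_fundamental (rho p \<phi>)"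
    unfolding upper_Boyd_def upper_fundamental_def by (intro INF_cong) (auto simp: norm_eq)
  ultimately show ?thesis
    using formula by (simp add: norm_eq)
qed

end
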